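(* Let $L=L(x,u,u_1)$ be a regular first order Lagrangian on $J^1(\pi)$, let $u_2^a=f^a(x,u,u_1)$, $a=1,\dots,q$, be its Euler-Lagrange equations, and let $\Theta$ be the Poincaré-Cartan $1$-form of $L$. Let $\lambda=\lambda(x,u,u_1)$ be a smooth function on $J^1(\pi)$, let $X$ be the $\lambda$-prolongation of a vector field $X_0=\xi\,\partial_x+\eta^a\,\partial_{u^a}$ on $M$, and let $R$ be a smooth function on $M$. Then $X$ is a (divergence) $\lambda$-variational symmetry for $L$ with divergence term $R$, i.e. $X(L)+L\,(D_x+\lambda)\xi=(D_x+\lambda)R$, if and only if in the covering $\{u_2^a=f^a(x,u,u_1),\ w_1=\lambda\}$, for any smooth function $A$ of $(x,u,u_1,w)$, the vector field $\tilde X=e^{w}(X+A\,\partial_w)$ is such that $$\mathcal{L}_{\tilde X}(\Theta)-d(e^{w}R)\in\tilde{\mathcal{C}},$$ where $\mathcal{L}$ denotes the Lie derivative and $\tilde{\mathcal{C}}$ is the contact ideal of the covering.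
   Context: Summation over repeated indices is understood. $\pi:M\to B$ is a $q$-dimensional bundle with $\dim B=1$, and $B$, $M$ have local coordinates $x$ and $(x,u^1,\dots,u^q)$. $J^k(\pi)$ is the $k$-th order jet bundle, with coordinates $(x,u^a,u_1^a,\dots,u_k^a)$, and $D_x=\partial_x+u_1^a\partial_{u^a}+u_2^a\partial_{u_1^a}+\cdots$ is the total derivative. $L$ is a regular first order Lagrangian (the matrix $\partial^2L/\partial u_1^a\partial u_1^b$ is nondegenerate). Its Euler-Lagrange equations are written in solved form $\mathcal{E}:\ u_2^a=f^a(x,u,u_1)$, $a=1,\dots,q$. Both $\mathcal{E}\subset J^2(\pi)$ and its infinite prolongation are parametrized by the coordinates $(x,u^a,u_1^a)$, and are thus identified with $J^1(\pi)$. The Poincaré-Cartan $1$-form is $\Theta=\frac{\partial L}{\partial u_1^a}(du^a-u_1^a\,dx)+L\,dx$; its pullback to the covering space (below) is denoted by the same letter. $\lambda$-prolongation: for a smooth function $\lambda$ on $J^1(\pi)$, the $\lambda$-prolongation of $X_0=\xi\partial_x+\eta^a\partial_{u^a}$ (with $\xi,\eta^a$ smooth functions on $M$) is $X=\xi\partial_x+\eta^a_{[\lambda,i]}\partial_{u^a_i}$ with $\eta^a_{[\lambda,0]}=\eta^a$ and $$\eta^a_{[\lambda,i]}=D_x(\eta^a_{[\lambda,i-1]})-D_x(\xi)u_i^a+\lambda(\eta^a_{[\lambda,i-1]}-\xi u_i^a).$$ Only the first order prolongation $X=\xi\partial_x+\eta^a\partial_{u^a}+\eta^a_{[\lambda,1]}\partial_{u_1^a}$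 on $J^1(\pi)$ is involved here. Definition: $X$ is called a (divergence) $\lambda$-variational symmetry for $L$ if $X$ is the $\lambda$-prolongation of a vector field $X_0=\xi\partial_x+\eta^a\partial_{u^a}$ on $M$ and $X(L)+L(D_x+\lambda)\xi=(D_x+\lambda)R$ for a function $R$ on $M$; here $(D_x+\lambda)g$ means $D_x(g)+\lambda g$. Covering: the covering space $\tilde{\mathcal{E}}$ is the infinite prolongation of the system $\{u_2^a=f^a(x,u,u_1),\ w_1=\lambda\}$, with one additional dependent variable $w$. It has coordinates $(x,u^a,u_1^a,w)$. Its contact ideal $\tilde{\mathcal{C}}$ is generated by the $1$-forms $dw-\lambda\,dx$, $du^a-u_1^a\,dx$, $du_1^a-f^a\,dx$ ($a=1,\dots,q$); a $1$-form belongs to $\tilde{\mathcal{C}}$ iff it is a linear combination of these with smooth function coefficients. *)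

theory Defs
  imports "HOL-Analysis.Analysis"
begin

section \<open>Smooth functions, vector fields and 1-forms on open sets\<close>

primrec Ck_on :: "nat \<Rightarrow> 'a::euclidean_space set \<Rightarrow> ('a \<Rightarrow> 'b::euclidean_space) \<Rightarrow> bool" where
  "Ck_on 0 S f \<longleftrightarrow> continuous_on S f"
| "Ck_on (Suc k) S f \<longleftrightarrow>
     (\<forall>x\<in>S. f differentiable (at x)) \<and> (\<forall>v. Ck_on k S (\<lambda>x. frechet_derivative f (at x) v))"

definition smooth_on :: "'a::euclidean_space set \<Rightarrow> ('a \<Rightarrow> 'b::euclidean_space) \<Rightarrow> bool" where
  "smooth_on S f \<longleftrightarrow> (\<forall>k. Ck_on k S f)"

text \<open>A vector field on an open set is the map that sends a point to the vector of
  components of the field.  A 1-form takes a point and a tangent vector at that point.\<close>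

type_synonym 'a vfield = "'a \<Rightarrow> 'a"
type_synonym 'a form1 = "'a \<Rightarrow> 'a \<Rightarrow> real"

definition vf_apply :: "'a::euclidean_space vfield \<Rightarrow> ('a \<Rightarrow> real) \<Rightarrow> 'a \<Rightarrow> real" where
  "vf_apply X g z = frechet_derivative g (at z) (X z)"

definition differential :: "('a::euclidean_space \<Rightarrow> real) \<Rightarrow> 'a form1" where
  "differential g z v = frechet_derivative g (at z) v"

definition pullback ::
  "('a::euclidean_space \<Rightarrow> 'b::euclidean_space) \<Rightarrow> 'b form1 \<Rightarrow> 'a form1" where
  "pullback F \<alpha> z v = \<alpha> (F z) (frechet_derivative F (at z) v)"

text \<open>In coordinates, the Lie derivative of the 1-form with components \<open>\<alpha>\<^sub>i\<close> has the
  components \<open>X\<^sup>j \<partial>\<^sub>j \<alpha>\<^sub>i + \<alpha>\<^sub>j \<partial>\<^sub>i X\<^sup>j\<close>, which are contracted with a constant vector \<open>v\<close> here.\<close>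

definition lie_derivative :: "'a::euclidean_space vfield \<Rightarrow> 'a form1 \<Rightarrow> 'a form1" where
  "lie_derivative X \<alpha> z v =
     frechet_derivative (\<lambda>y. \<alpha> y v) (at z) (X z) + \<alpha> z (frechet_derivative X (at z) v)"


section \<open>Jet spaces and the covering\<close>

text \<open>The coordinates are \<open>(x, u)\<close> on the total space \<open>M\<close>, \<open>(x, u, u\<^sub>1)\<close> and
  \<open>(x, u, u\<^sub>1, u\<^sub>2)\<close> on the first and second order jets, and \<open>(x, u, u\<^sub>1, w)\<close> on the covering.
  Here \<open>M\<close> is an open set (the image of a bundle chart) and the fibre coordinates
  \<open>u\<^sub>1\<close>, \<open>u\<^sub>2\<close>, \<open>w\<close> are unrestricted.\<close>

type_synonym 'q jet0 = "real \<times> (real^'q)"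
type_synonym 'q jet1 = "real \<times> (real^'q) \<times> (real^'q)"
type_synonym 'q jet2 = "real \<times> (real^'q) \<times> (real^'q) \<times> (real^'q)"
type_synonym 'q cov = "real \<times> (real^'q) \<times> (real^'q) \<times> real"

definition J1 :: "('q::finite) jet0 set \<Rightarrow> 'q jet1 set" where
  "J1 M = {(x, u, p). (x, u) \<in> M}"

definition covering :: "('q::finite) jet0 set \<Rightarrow> 'q cov set" where
  "covering M = {(x, u, p, w). (x, u) \<in> M}"

fun proj10 :: "('q::finite) jet1 \<Rightarrow> 'q jet0" where
  "proj10 (x, u, p) = (x, u)"

fun cov_proj :: "('q::finite) cov \<Rightarrow> 'q jet1" where
  "cov_proj (x, u, p, w) = (x, u, p)"

fun cov_w :: "('q::finite) cov \<Rightarrow> real" where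
  "cov_w (x, u, p, w) = w"

text \<open>The total derivative \<open>D\<^sub>x\<close>, on functions on \<open>M\<close> (where it is
  \<open>\<partial>\<^sub>x + u\<^sub>1\<^sup>a \<partial>\<^bsub>u\<^sup>a\<^esub>\<close>) and on functions on the first order jets (where it also
  contains \<open>u\<^sub>2\<^sup>a \<partial>\<^bsub>u\<^sub>1\<^sup>a\<^esub>\<close>), as a derivative along the vector of its coefficients.\<close>

fun Dx0 :: "('q::finite jet0 \<Rightarrow> real) \<Rightarrow> 'q jet1 \<Rightarrow> real" where
  "Dx0 g (x, u, p) = frechet_derivative g (at (x, u)) (1, p)"

fun Dx1 :: "('q::finite jet1 \<Rightarrow> real) \<Rightarrow> 'q jet2 \<Rightarrow> real" where
  "Dx1 g (x, u, p, s) = frechet_derivative g (at (x, u, p)) (1, p, s)"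

text \<open>\<open>(D\<^sub>x + \<lambda>) g\<close> for a function \<open>g\<close> on \<open>M\<close>.\<close>

definition Dx_lam :: "('q::finite jet1 \<Rightarrow> real) \<Rightarrow> ('q jet0 \<Rightarrow> real) \<Rightarrow> 'q jet1 \<Rightarrow> real" where
  "Dx_lam lam g z = Dx0 g z + lam z * g (proj10 z)"


section \<open>First order Lagrangians\<close>

definition pd_u :: "'q \<Rightarrow> ('q::finite jet1 \<Rightarrow> real) \<Rightarrow> 'q jet1 \<Rightarrow> real" where
  "pd_u a g z = frechet_derivative g (at z) (0, axis a 1, 0)"

definition pd_u1 :: "'q \<Rightarrow> ('q::finite jet1 \<Rightarrow> real) \<Rightarrow> 'q jet1 \<Rightarrow> real" where
  "pd_u1 a g z = frechet_derivative g (at z) (0, 0, axis a 1)"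

definition regular_lagrangian :: "'q::finite jet0 set \<Rightarrow> ('q jet1 \<Rightarrow> real) \<Rightarrow> bool" where
  "regular_lagrangian M L \<longleftrightarrow>
     smooth_on (J1 M) L \<and>
     (\<forall>z\<in>J1 M. invertible ((\<chi> a b. pd_u1 a (pd_u1 b L) z) :: real^'q^'q))"

fun euler_lagrange :: "('q::finite jet1 \<Rightarrow> real) \<Rightarrow> 'q \<Rightarrow> 'q jet2 \<Rightarrow> real" where
  "euler_lagrange L a (x, u, p, s) = pd_u a L (x, u, p) - Dx1 (pd_u1 a L) (x, u, p, s)"

definition euler_lagrange_solved_form ::
  "'q::finite jet0 set \<Rightarrow> ('q jet1 \<Rightarrow> real) \<Rightarrow> ('q jet1 \<Rightarrow> real^'q) \<Rightarrow> bool" where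
  "euler_lagrange_solved_form M L f \<longleftrightarrow>
     (\<forall>x u p s. (x, u) \<in> M \<longrightarrow>
        ((\<forall>a. euler_lagrange L a (x, u, p, s) = 0) \<longleftrightarrow> s = f (x, u, p)))"

fun poincare_cartan :: "('q::finite jet1 \<Rightarrow> real) \<Rightarrow> 'q jet1 form1" where
  "poincare_cartan L (x, u, p) (dx, du, dp) =
     (\<Sum>a\<in>UNIV. pd_u1 a L (x, u, p) * (du $ a - p $ a * dx)) + L (x, u, p) * dx"


section \<open>Prolongations, variational symmetries and the contact ideal\<close>

fun lam_prolongation ::
  "('q::finite jet1 \<Rightarrow> real) \<Rightarrow> ('q jet0 \<Rightarrow> real) \<Rightarrow> ('q jet0 \<Rightarrow> real^'q) \<Rightarrow> 'q jet1 vfield" where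
  "lam_prolongation lam \<xi> \<eta> (x, u, p) =
     (\<xi> (x, u), \<eta> (x, u),
      \<chi> a. Dx0 (\<lambda>y. \<eta> y $ a) (x, u, p) - Dx0 \<xi> (x, u, p) * p $ a
           + lam (x, u, p) * (\<eta> (x, u) $ a - \<xi> (x, u) * p $ a))"

text \<open>The vector field in question is the prolongation of \<open>\<xi> \<partial>\<^sub>x + \<eta>\<^sup>a \<partial>\<^bsub>u\<^sup>a\<^esub>\<close>;
  \<open>R\<close> is its divergence term.\<close>

definition lam_variational_symmetry ::
  "'q::finite jet0 set \<Rightarrow> ('q jet1 \<Rightarrow> real) \<Rightarrow> ('q jet1 \<Rightarrow> real) \<Rightarrow>
   ('q jet0 \<Rightarrow> real) \<Rightarrow> ('q jet0 \<Rightarrow> real^'q) \<Rightarrow> ('q jet0 \<Rightarrow> real) \<Rightarrow> bool" where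
  "lam_variational_symmetry M L lam \<xi> \<eta> R \<longleftrightarrow>
     (\<forall>z\<in>J1 M. vf_apply (lam_prolongation lam \<xi> \<eta>) L z + L z * Dx_lam lam \<xi> z = Dx_lam lam R z)"

text \<open>The field \<open>e\<^sup>w (X + A \<partial>\<^sub>w)\<close> on the covering.\<close>

fun cov_lift :: "'q::finite jet1 vfield \<Rightarrow> ('q cov \<Rightarrow> real) \<Rightarrow> 'q cov vfield" where
  "cov_lift X A (x, u, p, w) =
     (case X (x, u, p) of (X\<^sub>x, X\<^sub>u, X\<^sub>p) \<Rightarrow> exp w *\<^sub>R (X\<^sub>x, X\<^sub>u, X\<^sub>p, A (x, u, p, w)))"

text \<open>The coefficients belong to \<open>dw - \<lambda> dx\<close>, \<open>du\<^sup>a - u\<^sub>1\<^sup>a dx\<close> and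
  \<open>du\<^sub>1\<^sup>a - f\<^sup>a dx\<close>; the names \<open>dx\<close>, \<open>du\<close>, \<open>dp\<close>, \<open>dw\<close> stand for the components of the
  tangent vector on which the forms are evaluated.\<close>

definition contact_ideal ::
  "'q::finite jet0 set \<Rightarrow> ('q jet1 \<Rightarrow> real^'q) \<Rightarrow> ('q jet1 \<Rightarrow> real) \<Rightarrow> 'q cov form1 set" where
  "contact_ideal M f lam = {\<omega>. \<exists>(c :: 'q cov \<Rightarrow> real) (\<alpha> :: 'q \<Rightarrow> 'q cov \<Rightarrow> real) (\<beta> :: 'q \<Rightarrow> 'q cov \<Rightarrow> real).
     smooth_on (covering M) c \<and>
     (\<forall>a. smooth_on (covering M) (\<alpha> a)) \<and> (\<forall>a. smooth_on (covering M) (\<beta> a)) \<and>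
     (\<forall>x u p w dx du dp dw. (x, u, p, w) \<in> covering M \<longrightarrow>
        \<omega> (x, u, p, w) (dx, du, dp, dw) =
          c (x, u, p, w) * (dw - lam (x, u, p) * dx)
          + (\<Sum>a\<in>UNIV. \<alpha> a (x, u, p, w) * (du $ a - p $ a * dx))
          + (\<Sum>a\<in>UNIV. \<beta> a (x, u, p, w) * (dp $ a - f (x, u, p) $ a * dx)))}"

end

theory Submission
  imports Defs
begin

text \<open>
  Write \<open>D\<close> for the total derivative
  \<open>\<partial>\<^sub>x + u\<^sub>1\<^sup>a \<partial>\<^bsub>u\<^sup>a\<^esub> + f\<^sup>a \<partial>\<^bsub>u\<^sub>1\<^sup>a\<^esub> + \<lambda> \<partial>\<^sub>w\<close>
  of the covering and \<open>Z\<close> for the nonlocal field \<open>e\<^sup>w (X + A \<partial>\<^sub>w)\<close>.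

  The contact forms together with \<open>dx\<close> are a coframe, and \<open>D\<close> is the vector that the contact
  forms annihilate and on which \<open>dx\<close> is 1.  A smooth 1-form \<open>\<omega>\<close> is therefore in the contact
  ideal iff \<open>\<omega>(D) = 0\<close>, because its coefficients in the coframe are its values on coordinate
  vectors and on \<open>D\<close> (\<open>contact_ideal_iff\<close>).  Everything reduces to evaluating
  \<open>\<omega> = \<L>\<^sub>Z \<Theta> - d(e\<^sup>w R)\<close> on \<open>D\<close>.

  For a function \<open>g\<close> on the total space, \<open>D(e\<^sup>w g) = e\<^sup>w (D\<^sub>x + \<lambda>) g\<close>, since \<open>D w = \<lambda>\<close>
  (\<open>exp_weighted_derivative\<close>).  This disposes of the term with \<open>R\<close>.  It also shows why the
  \<open>\<lambda>\<close>-prolongation is the right one: the factor \<open>e\<^sup>w\<close> turns the operator \<open>D\<^sub>x + \<lambda>\<close> in the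
  prolongation formula into an ordinary total derivative, so that \<open>Z\<close> satisfies
  \<open>[D, Z] = (e\<^sup>w (D\<^sub>x + \<lambda>) \<xi>) D\<close> modulo \<open>\<partial>\<^bsub>u\<^sub>1\<^esub>\<close> and \<open>\<partial>\<^sub>w\<close> (\<open>cov_lift_commutator\<close>).
  As \<open>\<Theta>(D) = L\<close>, and \<open>\<Theta>\<close> annihilates \<open>\<partial>\<^bsub>u\<^sub>1\<^esub>\<close> and \<open>\<partial>\<^sub>w\<close>, the product rule for the
  Lie derivative (\<open>lie_derivative_contract\<close>) gives
  \<open>(\<L>\<^sub>Z \<Theta>)(D) = Z(\<Theta>(D)) + \<Theta>([D, Z]) = e\<^sup>w (X(L) + L (D\<^sub>x + \<lambda>) \<xi>)\<close>
  (\<open>lie_poincare_cartan_contract\<close>).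

  Hence \<open>\<omega>(D)\<close> is \<open>e\<^sup>w\<close> times the difference of the two sides of the defining equation of a
  variational symmetry, whatever \<open>A\<close> is, and \<open>e\<^sup>w\<close> has no zeros.
\<close>

section \<open>Calculus of smooth functions\<close>

lemma frechet_derivative_eqI:
  "(f has_derivative D) (at x) \<Longrightarrow> frechet_derivative f (at x) v = D v"
  by (metis frechet_derivative_at)

text \<open>The library's derivative at a point is a choice among all candidates.  Equality of the sets
  of candidates makes the choices equal even where the functions are not differentiable.\<close>

lemma frechet_derivative_cong_open:
  assumes "open S" "x \<in> S" "\<And>y. y \<in> S \<Longrightarrow> f y = g y"
  shows "frechet_derivative f (at x) = frechet_derivative g (at x)"
proof -
  have "(f has_derivative D) (at x) \<longleftrightarrow> (g has_derivative D) (at x)" for D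
    using assms by (metis has_derivative_transform_within_open)
  then show ?thesis unfolding frechet_derivative_def by simp
qed

lemma Ck_on_cong:
  assumes "open S" "\<And>y. y \<in> S \<Longrightarrow> f y = g y" "Ck_on k S f"
  shows "Ck_on k S g"
  using assms(2,3)
proof (induction k arbitrary: f g)
  case 0
  then show ?case by (simp cong: continuous_on_cong)
next
  case (Suc k)
  have "g differentiable (at x)" if "x \<in> S" for x
    using Suc.prems that assms(1)
    unfolding Ck_on.simps differentiable_def by (metis has_derivative_transform_within_open)
  moreover have "Ck_on k S (\<lambda>x. frechet_derivative g (at x) v)" for v
  proof (rule Suc.IH)
    show "frechet_derivative f (at y) v = frechet_derivative g (at y) v" if "y \<in> S" for y
      using frechet_derivative_cong_open[OF assms(1) that, of f g] Suc.prems(1) by simp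
    show "Ck_on k S (\<lambda>x. frechet_derivative f (at x) v)" using Suc.prems(2) by simp
  qed
  ultimately show ?case by simp
qed

text \<open>Introduces \<open>Ck_on\<close> from derivatives given by explicit formulas, as the differentiation
  rules deliver them.\<close>

lemma Ck_on_SucI:
  assumes "open S" "\<And>x. x \<in> S \<Longrightarrow> (f has_derivative D x) (at x)"
    "\<And>v. Ck_on k S (\<lambda>x. D x v)"
  shows "Ck_on (Suc k) S f"
proof -
  have "Ck_on k S (\<lambda>x. frechet_derivative f (at x) v)" for v
    by (rule Ck_on_cong[OF assms(1) _ assms(3)[of v]])
      (simp add: frechet_derivative_eqI[OF assms(2)])
  then show ?thesis using assms(2) by (auto simp: differentiable_def)
qed

lemma Ck_on_Suc_has_derivative:
  "Ck_on (Suc k) S f \<Longrightarrow> x \<in> S \<Longrightarrow> (f has_derivative frechet_derivative f (at x)) (at x)"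
  by (simp add: frechet_derivative_works)

lemma Ck_on_Suc_derivative:
  "Ck_on (Suc k) S f \<Longrightarrow> Ck_on k S (\<lambda>x. frechet_derivative f (at x) v)"
  by simp

text \<open>The product rule below involves the factors and not only their derivatives, so that its
  induction has to lower the order of the factors.\<close>

lemma Ck_on_Suc_imp_Ck_on: "Ck_on (Suc k) S f \<Longrightarrow> Ck_on k S f"
proof (induction k arbitrary: f)
  case 0
  then show ?case
    by (auto intro!: continuous_at_imp_continuous_on differentiable_imp_continuous_within)
next
  case (Suc k)
  then show ?case by (metis Ck_on.simps(2))
qed

lemma Ck_on_const: "Ck_on k S (\<lambda>x. c)"
proof (induction k arbitrary: c)
  case (Suc k)
  have "frechet_derivative (\<lambda>x. c) (at x) v = 0" for x v :: 'a
    by (rule frechet_derivative_eqI) simp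
  then show ?case using Suc[of 0] by simp
qed simp

lemma Ck_on_add:
  assumes "open S" shows "Ck_on k S f \<Longrightarrow> Ck_on k S g \<Longrightarrow> Ck_on k S (\<lambda>x. f x + g x)"
proof (induction k arbitrary: f g)
  case 0
  then show ?case by (simp add: continuous_on_add)
next
  case (Suc k)
  show ?case
    by (rule Ck_on_SucI[OF assms has_derivative_add
          [OF Ck_on_Suc_has_derivative[OF Suc.prems(1)] Ck_on_Suc_has_derivative[OF Suc.prems(2)]]
          Suc.IH[OF Ck_on_Suc_derivative[OF Suc.prems(1)] Ck_on_Suc_derivative[OF Suc.prems(2)]]])
qed

lemma Ck_on_bilinear:
  assumes "open S" "bounded_bilinear B"
  shows "Ck_on k S f \<Longrightarrow> Ck_on k S g \<Longrightarrow> Ck_on k S (\<lambda>x. B (f x) (g x))"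
proof (induction k arbitrary: f g)
  case 0
  then show ?case by (simp add: bounded_bilinear.continuous_on[OF assms(2)])
next
  case (Suc k)
  show ?case
  proof (rule Ck_on_SucI[OF assms(1)], rule bounded_bilinear.FDERIV[OF assms(2)])
    show "Ck_on k S (\<lambda>x. B (f x) (frechet_derivative g (at x) v)
        + B (frechet_derivative f (at x) v) (g x))" for v
      by (rule Ck_on_add[OF assms(1)
            Suc.IH[OF Ck_on_Suc_imp_Ck_on[OF Suc.prems(1)] Ck_on_Suc_derivative[OF Suc.prems(2)]]
            Suc.IH[OF Ck_on_Suc_derivative[OF Suc.prems(1)] Ck_on_Suc_imp_Ck_on[OF Suc.prems(2)]]])
  qed (rule Ck_on_Suc_has_derivative[OF Suc.prems(1)] Ck_on_Suc_has_derivative[OF Suc.prems(2)],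
      assumption)+
qed

lemma Ck_on_exp:
  fixes g :: "'a::euclidean_space \<Rightarrow> real"
  assumes "open S" shows "Ck_on k S g \<Longrightarrow> Ck_on k S (\<lambda>x. exp (g x))"
proof (induction k arbitrary: g)
  case 0
  then show ?case by (simp add: continuous_on_exp)
next
  case (Suc k)
  show ?case
  proof (rule Ck_on_SucI[OF assms])
    show "((\<lambda>x. exp (g x)) has_derivative (\<lambda>v. frechet_derivative g (at x) v * exp (g x))) (at x)"
      if "x \<in> S" for x
      using has_derivative_exp[OF Ck_on_Suc_has_derivative[OF Suc.prems that]]
      by (simp add: mult.commute)
    show "Ck_on k S (\<lambda>x. frechet_derivative g (at x) v * exp (g x))" for v
      by (rule Ck_on_bilinear[OF assms bounded_bilinear_mult Ck_on_Suc_derivative[OF Suc.prems]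
            Suc.IH[OF Ck_on_Suc_imp_Ck_on[OF Suc.prems]]])
  qed
qed

lemma open_vimage_linear:
  fixes P :: "'a::euclidean_space \<Rightarrow> 'b::euclidean_space"
  shows "linear P \<Longrightarrow> open S \<Longrightarrow> open (P -` S)"
  by (simp add: continuous_open_vimage linear_continuous_at linear_linear)

lemma has_derivative_compose_linear:
  fixes P :: "'a::euclidean_space \<Rightarrow> 'b::euclidean_space"
  assumes "linear P" "(f has_derivative D) (at (P z))"
  shows "((\<lambda>y. f (P y)) has_derivative (\<lambda>v. D (P v))) (at z)"
  by (rule has_derivative_compose[OF bounded_linear_imp_has_derivative, of P, OF _ assms(2)])
    (simp add: assms(1) linear_linear)

lemma Ck_on_compose_linear:
  assumes P: "linear P" and "open S"
  shows "Ck_on k S f \<Longrightarrow> Ck_on k (P -` S) (\<lambda>x. f (P x))"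
proof (induction k arbitrary: f)
  case 0
  have "continuous_on (P -` S) P"
    by (simp add: P linear_continuous_on linear_linear)
  with 0 show ?case by (auto intro: continuous_on_compose2)
next
  case (Suc k)
  have "open (P -` S)" by (rule open_vimage_linear[OF P assms(2)])
  then show ?case
  proof (rule Ck_on_SucI)
    show "((\<lambda>x. f (P x)) has_derivative (\<lambda>v. frechet_derivative f (at (P x)) (P v))) (at x)"
      if "x \<in> P -` S" for x
      using that by (intro has_derivative_compose_linear[OF P]
          Ck_on_Suc_has_derivative[OF Suc.prems]) simp
    show "Ck_on k (P -` S) (\<lambda>x. frechet_derivative f (at (P x)) (P v))" for v
      by (rule Suc.IH[OF Ck_on_Suc_derivative[OF Suc.prems]])
  qed
qed

lemma smooth_on_cong:
  "open S \<Longrightarrow> (\<And>y. y \<in> S \<Longrightarrow> f y = g y) \<Longrightarrow> smooth_on S f \<Longrightarrow> smooth_on S g"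
  unfolding smooth_on_def by (metis Ck_on_cong)

lemma smooth_on_has_derivative:
  "smooth_on S f \<Longrightarrow> x \<in> S \<Longrightarrow> (f has_derivative frechet_derivative f (at x)) (at x)"
  unfolding smooth_on_def by (metis Ck_on_Suc_has_derivative)

lemma smooth_on_linear_derivative:
  "smooth_on S f \<Longrightarrow> x \<in> S \<Longrightarrow> linear (frechet_derivative f (at x))"
  using has_derivative_linear smooth_on_has_derivative by blast

lemma smooth_on_derivative:
  "smooth_on S f \<Longrightarrow> smooth_on S (\<lambda>x. frechet_derivative f (at x) v)"
  unfolding smooth_on_def by (metis Ck_on_Suc_derivative)

lemma smooth_on_const: "smooth_on S (\<lambda>x. c)"
  unfolding smooth_on_def by (simp add: Ck_on_const)

lemma smooth_on_add:
  "open S \<Longrightarrow> smooth_on S f \<Longrightarrow> smooth_on S g \<Longrightarrow> smooth_on S (\<lambda>x. f x + g x)"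
  unfolding smooth_on_def by (simp add: Ck_on_add)

lemma smooth_on_bilinear:
  "open S \<Longrightarrow> bounded_bilinear B \<Longrightarrow> smooth_on S f \<Longrightarrow> smooth_on S g
    \<Longrightarrow> smooth_on S (\<lambda>x. B (f x) (g x))"
  unfolding smooth_on_def by (simp add: Ck_on_bilinear)

lemmas smooth_on_mult = smooth_on_bilinear[OF _ bounded_bilinear_mult]
lemmas smooth_on_scaleR = smooth_on_bilinear[OF _ bounded_bilinear_scaleR]

lemma smooth_on_diff:
  fixes f g :: "'a::euclidean_space \<Rightarrow> real"
  assumes "open S" "smooth_on S f" "smooth_on S g" shows "smooth_on S (\<lambda>x. f x - g x)"
  using smooth_on_add[OF assms(1,2) smooth_on_mult[OF assms(1) smooth_on_const[of _ "-1"] assms(3)]]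
  by simp

lemma smooth_on_sum:
  "open S \<Longrightarrow> (\<And>i. i \<in> I \<Longrightarrow> smooth_on S (f i)) \<Longrightarrow> smooth_on S (\<lambda>x. \<Sum>i\<in>I. f i x)"
  by (induction I rule: infinite_finite_induct) (auto intro: smooth_on_const smooth_on_add)

lemma smooth_on_exp:
  fixes g :: "'a::euclidean_space \<Rightarrow> real"
  shows "open S \<Longrightarrow> smooth_on S g \<Longrightarrow> smooth_on S (\<lambda>x. exp (g x))"
  unfolding smooth_on_def by (simp add: Ck_on_exp)

lemma smooth_on_compose_linear:
  "linear P \<Longrightarrow> open S \<Longrightarrow> smooth_on S f \<Longrightarrow> smooth_on (P -` S) (\<lambda>x. f (P x))"
  unfolding smooth_on_def by (simp add: Ck_on_compose_linear)

text \<open>Each derivative is constant, which gives every positive order without an induction.\<close>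

lemma smooth_on_linear:
  assumes "open S" "linear P" shows "smooth_on S P"
proof -
  have "Ck_on (Suc k) S P" for k
    using assms by (intro Ck_on_SucI[where D = "\<lambda>_. P"])
      (auto intro: bounded_linear_imp_has_derivative simp: linear_linear Ck_on_const)
  then show ?thesis unfolding smooth_on_def by (metis Ck_on_Suc_imp_Ck_on)
qed

lemma linear_sum_Basis:
  assumes "linear P"
  shows "P v = (\<Sum>b\<in>Basis. (v \<bullet> b) *\<^sub>R P b)"
proof -
  have "P v = P (\<Sum>b\<in>Basis. (v \<bullet> b) *\<^sub>R b)" by (simp add: euclidean_representation)
  then show ?thesis by (simp add: linear_sum[OF assms] linear_cmul[OF assms])
qed

text \<open>A linear map is a combination of scalar products with constant coefficients, which reduces
  this to products and sums.\<close>

lemma smooth_on_linear_image: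
  assumes "open S" "linear P" "smooth_on S f" shows "smooth_on S (\<lambda>x. P (f x))"
  unfolding linear_sum_Basis[OF assms(2), of "f _"]
  by (intro smooth_on_sum smooth_on_scaleR smooth_on_bilinear[OF _ bounded_bilinear_inner]
      smooth_on_const assms)

lemma smooth_on_Pair:
  assumes "open S" "smooth_on S f" "smooth_on S g" shows "smooth_on S (\<lambda>x. (f x, g x))"
proof -
  have "smooth_on S (\<lambda>x. (f x, 0) + (0, g x))"
    by (intro smooth_on_add smooth_on_linear_image[where P = "\<lambda>y. (y, 0)"]
        smooth_on_linear_image[where P = "\<lambda>y. (0, y)"] assms) (auto intro!: linearI)
  then show ?thesis by simp
qed

lemma smooth_on_vec_lambda:
  fixes g :: "'q::finite \<Rightarrow> 'a::euclidean_space \<Rightarrow> real"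
  assumes "open S" "\<And>a. smooth_on S (g a)" shows "smooth_on S (\<lambda>x. \<chi> a. g a x)"
proof -
  have "smooth_on S (\<lambda>x. \<Sum>a\<in>UNIV. g a x *\<^sub>R axis a (1::real))"
    by (intro smooth_on_sum smooth_on_scaleR smooth_on_const assms)
  moreover have "(\<Sum>a\<in>UNIV. g a x *\<^sub>R axis a (1::real)) = (\<chi> a. g a x)" for x
    using basis_expansion[of "\<chi> a. g a x"] by (simp add: scalar_mult_eq_scaleR)
  ultimately show ?thesis by simp
qed


section \<open>Smooth 1-forms\<close>

text \<open>A \<open>form1\<close> need not be linear on tangent vectors; linearity is therefore part of this
  notion.  Smoothness on constant vectors amounts to smoothness of the components.\<close>

definition smooth_form1 :: "'a::euclidean_space set \<Rightarrow> 'a form1 \<Rightarrow> bool" where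
  "smooth_form1 S \<alpha> \<longleftrightarrow> (\<forall>z\<in>S. linear (\<alpha> z)) \<and> (\<forall>v. smooth_on S (\<lambda>z. \<alpha> z v))"

lemma smooth_form1_linear: "smooth_form1 S \<alpha> \<Longrightarrow> z \<in> S \<Longrightarrow> linear (\<alpha> z)"
  by (simp add: smooth_form1_def)

lemma smooth_form1_smooth: "smooth_form1 S \<alpha> \<Longrightarrow> smooth_on S (\<lambda>z. \<alpha> z v)"
  by (simp add: smooth_form1_def)

lemma smooth_form1_diff:
  assumes "open S" "smooth_form1 S \<alpha>" "smooth_form1 S \<beta>"
  shows "smooth_form1 S (\<lambda>z v. \<alpha> z v - \<beta> z v)"
  using assms by (auto simp: smooth_form1_def intro: smooth_on_diff linear_compose_sub)

lemma smooth_form1_differential: "smooth_on S g \<Longrightarrow> smooth_form1 S (differential g)"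
  by (simp add: smooth_form1_def differential_def[abs_def] smooth_on_derivative
      smooth_on_linear_derivative)

lemma pullback_linear: "linear P \<Longrightarrow> pullback P \<alpha> z v = \<alpha> (P z) (P v)"
  using frechet_derivative_eqI[OF bounded_linear_imp_has_derivative[of P], of z v]
  by (simp add: pullback_def linear_linear)

lemma smooth_form1_pullback_linear:
  assumes "linear P" "open S" "smooth_form1 S \<alpha>"
  shows "smooth_form1 (P -` S) (pullback P \<alpha>)"
  unfolding smooth_form1_def pullback_linear[OF assms(1)]
  using assms linear_compose[OF assms(1)] smooth_on_compose_linear[OF assms(1,2)]
  by (auto simp: smooth_form1_def o_def pullback_linear[OF assms(1)])

lemma smooth_form1_contract:
  assumes "open S" "smooth_form1 S \<alpha>" "smooth_on S Y"
  shows "smooth_on S (\<lambda>z. \<alpha> z (Y z))"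
proof (rule smooth_on_cong[OF assms(1)])
  show "smooth_on S (\<lambda>z. \<Sum>b\<in>Basis. (Y z \<bullet> b) *\<^sub>R \<alpha> z b)"
    by (intro smooth_on_sum smooth_on_scaleR smooth_on_bilinear[OF _ bounded_bilinear_inner]
        smooth_on_const smooth_form1_smooth[OF assms(2)] assms)
  show "(\<Sum>b\<in>Basis. (Y z \<bullet> b) *\<^sub>R \<alpha> z b) = \<alpha> z (Y z)" if "z \<in> S" for z
    by (rule linear_sum_Basis[OF smooth_form1_linear[OF assms(2) that], symmetric])
qed

lemma smooth_on_vf_apply:
  assumes "open S" "smooth_on S Y" "smooth_on S g" shows "smooth_on S (vf_apply Y g)"
  using smooth_form1_contract[OF assms(1) smooth_form1_differential[OF assms(3)] assms(2)]
  by (simp add: vf_apply_def[abs_def] differential_def)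

text \<open>The product rule for the pairing of a form with a field: in \<open>\<alpha>\<^sub>b Y\<^sup>b\<close> the components of the
  form are differentiated first with \<open>Y\<close> held constant, and the components of \<open>Y\<close> afterwards.\<close>

lemma has_derivative_form1_contract:
  assumes "open S" "smooth_form1 S \<alpha>" "z \<in> S" "(Y has_derivative Y') (at z)"
  shows "((\<lambda>y. \<alpha> y (Y y)) has_derivative
    (\<lambda>h. frechet_derivative (\<lambda>y. \<alpha> y (Y z)) (at z) h + \<alpha> z (Y' h))) (at z)"
proof -
  have lin: "linear (\<alpha> y)" if "y \<in> S" for y
    using smooth_form1_linear[OF assms(2) that] .
  have D: "((\<lambda>y. \<alpha> y v) has_derivative frechet_derivative (\<lambda>y. \<alpha> y v) (at z)) (at z)" for v
    using smooth_on_has_derivative[OF smooth_form1_smooth[OF assms(2)] assms(3)] .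
  define G where "G h = (\<Sum>b\<in>Basis. (Y z \<bullet> b) *\<^sub>R frechet_derivative (\<lambda>y. \<alpha> y b) (at z) h)" for h
  have expand: "(\<Sum>b\<in>Basis. (v \<bullet> b) *\<^sub>R \<alpha> y b) = \<alpha> y v" if "y \<in> S" for y v
    by (rule linear_sum_Basis[OF lin[OF that], symmetric])
  have "((\<lambda>y. \<Sum>b\<in>Basis. (Y z \<bullet> b) *\<^sub>R \<alpha> y b) has_derivative G) (at z)"
    unfolding G_def by (intro has_derivative_sum has_derivative_scaleR_right D)
  then have "((\<lambda>y. \<alpha> y (Y z)) has_derivative G) (at z)"
    by (rule has_derivative_transform_within_open[OF _ assms(1,3)]) (rule expand)
  then have G: "frechet_derivative (\<lambda>y. \<alpha> y (Y z)) (at z) h = G h" for h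
    by (rule frechet_derivative_eqI)
  have "((\<lambda>y. \<Sum>b\<in>Basis. (Y y \<bullet> b) *\<^sub>R \<alpha> y b) has_derivative
      (\<lambda>h. \<Sum>b\<in>Basis. (Y z \<bullet> b) *\<^sub>R frechet_derivative (\<lambda>y. \<alpha> y b) (at z) h
        + (Y' h \<bullet> b) *\<^sub>R \<alpha> z b)) (at z)"
    by (intro has_derivative_sum has_derivative_scaleR D has_derivative_inner_left assms(4))
  then have "((\<lambda>y. \<Sum>b\<in>Basis. (Y y \<bullet> b) *\<^sub>R \<alpha> y b) has_derivative (\<lambda>h. G h + \<alpha> z (Y' h))) (at z)"
    using expand[OF assms(3)] by (simp only: sum.distrib G_def)
  then show ?thesis
    unfolding G by (rule has_derivative_transform_within_open[OF _ assms(1,3)]) (rule expand)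
qed

text \<open>The first term of the Lie derivative differentiates \<open>\<alpha>\<close> evaluated on a constant vector
  \<open>v\<close>; it is linear in \<open>v\<close> because \<open>\<alpha>\<close> is, at all points near the given one.\<close>

lemma smooth_form1_lie_derivative:
  assumes "open S" "smooth_form1 S \<alpha>" "smooth_on S X"
  shows "smooth_form1 S (lie_derivative X \<alpha>)"
  unfolding smooth_form1_def
proof (intro conjI ballI allI)
  fix v
  have "smooth_on S (\<lambda>z. vf_apply X (\<lambda>y. \<alpha> y v) z + \<alpha> z (frechet_derivative X (at z) v))"
    by (rule smooth_on_add[OF assms(1)
          smooth_on_vf_apply[OF assms(1,3) smooth_form1_smooth[OF assms(2)]]
          smooth_form1_contract[OF assms(1,2) smooth_on_derivative[OF assms(3)]]])
  then show "smooth_on S (\<lambda>z. lie_derivative X \<alpha> z v)"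
    by (simp add: lie_derivative_def vf_apply_def)
next
  fix z assume z: "z \<in> S"
  have lin: "linear (\<alpha> y)" if "y \<in> S" for y
    using smooth_form1_linear[OF assms(2) that] .
  have D: "((\<lambda>y. \<alpha> y v) has_derivative frechet_derivative (\<lambda>y. \<alpha> y v) (at z)) (at z)" for v
    using smooth_on_has_derivative[OF smooth_form1_smooth[OF assms(2)] z] .
  have "linear (\<lambda>v. frechet_derivative (\<lambda>y. \<alpha> y v) (at z) (X z))"
  proof (rule linearI)
    fix v w and c :: real
    have "((\<lambda>y. \<alpha> y (v + w)) has_derivative (\<lambda>h. frechet_derivative (\<lambda>y. \<alpha> y v) (at z) h
        + frechet_derivative (\<lambda>y. \<alpha> y w) (at z) h)) (at z)"
      by (rule has_derivative_transform_within_open[OF has_derivative_add[OF D D] assms(1) z])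
        (simp add: linear_add lin)
    then show "frechet_derivative (\<lambda>y. \<alpha> y (v + w)) (at z) (X z) =
        frechet_derivative (\<lambda>y. \<alpha> y v) (at z) (X z) + frechet_derivative (\<lambda>y. \<alpha> y w) (at z) (X z)"
      by (rule frechet_derivative_eqI)
    have "((\<lambda>y. \<alpha> y (c *\<^sub>R v)) has_derivative
        (\<lambda>h. c *\<^sub>R frechet_derivative (\<lambda>y. \<alpha> y v) (at z) h)) (at z)"
      by (rule has_derivative_transform_within_open[OF has_derivative_scaleR_right[OF D] assms(1) z])
        (simp add: linear_cmul lin)
    then show "frechet_derivative (\<lambda>y. \<alpha> y (c *\<^sub>R v)) (at z) (X z) =
        c *\<^sub>R frechet_derivative (\<lambda>y. \<alpha> y v) (at z) (X z)"
      by (rule frechet_derivative_eqI)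
  qed
  then show "linear (lie_derivative X \<alpha> z)"
    using linear_compose_add
      [OF _ linear_compose[OF smooth_on_linear_derivative[OF assms(3) z] lin[OF z]]]
    by (simp add: lie_derivative_def[abs_def] o_def)
qed

text \<open>The product rule turns the definition of the Lie derivative into
  \<open>(\<L>\<^sub>X \<alpha>)(Y) = X(\<alpha>(Y)) - \<alpha>([X, Y])\<close>.  Here \<open>Y\<close> only has to be differentiable at the point in
  question, so that any convenient extension of a given tangent vector will do.\<close>

lemma lie_derivative_contract:
  assumes "open S" "smooth_form1 S \<alpha>" "z \<in> S" "(Y has_derivative Y') (at z)"
  shows "lie_derivative X \<alpha> z (Y z) = vf_apply X (\<lambda>y. \<alpha> y (Y y)) z
    + \<alpha> z (frechet_derivative X (at z) (Y z) - Y' (X z))"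
  using frechet_derivative_eqI[OF has_derivative_form1_contract[OF assms], of "X z"]
  by (simp add: lie_derivative_def vf_apply_def linear_diff[OF smooth_form1_linear[OF assms(2,3)]])


section \<open>Coordinates on the jets and on the covering\<close>

lemma proj10_conv: "proj10 = (\<lambda>z. (fst z, fst (snd z)))"
  by (auto simp: fun_eq_iff)

lemma cov_proj_conv: "cov_proj = (\<lambda>z. (fst z, fst (snd z), fst (snd (snd z))))"
  by (auto simp: fun_eq_iff)

lemma cov_w_conv: "cov_w = (\<lambda>z. snd (snd (snd z)))"
  by (auto simp: fun_eq_iff)

lemma linear_proj10: "linear (proj10 :: 'q::finite jet1 \<Rightarrow> _)"
  unfolding proj10_conv by (rule linearI) auto

lemma linear_cov_proj: "linear (cov_proj :: 'q::finite cov \<Rightarrow> _)"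
  unfolding cov_proj_conv by (rule linearI) auto

lemma linear_cov_w: "linear (cov_w :: 'q::finite cov \<Rightarrow> _)"
  unfolding cov_w_conv by (rule linearI) auto

lemma linear_snd_snd: "linear (\<lambda>y :: 'q::finite jet1. snd (snd y))"
  by (rule linearI) auto

lemma linear_fst_snd:
  "linear (\<lambda>y :: 'a::real_vector \<times> 'b::real_vector \<times> 'c::real_vector. fst (snd y))"
  by (rule linearI) auto

lemma J1_vimage: "J1 M = proj10 -` M"
  by (auto simp: J1_def)

lemma covering_vimage: "covering M = cov_proj -` J1 M"
  by (auto simp: covering_def J1_def)

lemma open_J1: "open M \<Longrightarrow> open (J1 M)"
  unfolding J1_vimage by (rule open_vimage_linear[OF linear_proj10])

lemma open_covering: "open M \<Longrightarrow> open (covering M)"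
  unfolding covering_vimage by (rule open_vimage_linear[OF linear_cov_proj open_J1])

lemma smooth_on_J1_lift: "open M \<Longrightarrow> smooth_on M g \<Longrightarrow> smooth_on (J1 M) (\<lambda>z. g (proj10 z))"
  unfolding J1_vimage by (rule smooth_on_compose_linear[OF linear_proj10])

lemma smooth_on_covering_lift:
  "open M \<Longrightarrow> smooth_on (J1 M) g \<Longrightarrow> smooth_on (covering M) (\<lambda>z. g (cov_proj z))"
  unfolding covering_vimage by (rule smooth_on_compose_linear[OF linear_cov_proj open_J1])

lemma linear_sum_axis:
  fixes T :: "real^'q::finite \<Rightarrow> real"
  assumes "linear T" shows "(\<Sum>a\<in>UNIV. T (axis a 1) * y $ a) = T y"
proof -
  have "T y = T (\<Sum>a\<in>UNIV. y $ a *\<^sub>R axis a 1)"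
    using basis_expansion[of y] by (simp add: scalar_mult_eq_scaleR)
  then show ?thesis by (simp add: linear_sum[OF assms] linear_cmul[OF assms] mult.commute)
qed

text \<open>The tangent vector \<open>(1, p, f, \<lambda>)\<close> is the total derivative of the covering.  It completes the
  coordinate vectors \<open>\<partial>\<^bsub>u\<^esub>\<close>, \<open>\<partial>\<^bsub>u\<^sub>1\<^esub>\<close>, \<open>\<partial>\<^sub>w\<close> to the frame dual to \<open>dx\<close> and the contact
  forms, so that the values of \<open>\<omega>\<close> on the coordinate vectors are the only possible coefficients,
  and they are smooth because the vectors are constant.\<close>

lemma contact_ideal_iff:
  fixes M :: "'q::finite jet0 set"
  assumes "smooth_form1 (covering M) \<omega>"
  shows "\<omega> \<in> contact_ideal M f lam \<longleftrightarrow>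
    (\<forall>x u p w. (x, u) \<in> M \<longrightarrow> \<omega> (x, u, p, w) (1, p, f (x, u, p), lam (x, u, p)) = 0)"
    (is "?L \<longleftrightarrow> ?R")
proof
  assume ?L
  then obtain c \<alpha> \<beta> where
    "\<And>x u p w dx du dp dw. (x, u, p, w) \<in> covering M \<Longrightarrow>
        \<omega> (x, u, p, w) (dx, du, dp, dw) =
          c (x, u, p, w) * (dw - lam (x, u, p) * dx)
          + (\<Sum>a\<in>UNIV. \<alpha> a (x, u, p, w) * (du $ a - p $ a * dx))
          + (\<Sum>a\<in>UNIV. \<beta> a (x, u, p, w) * (dp $ a - f (x, u, p) $ a * dx))"
    unfolding contact_ideal_def by blast
  then show ?R by (simp add: covering_def)
next
  assume R: ?R
  have "\<omega> (x, u, p, w) (dx, du, dp, dw) =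
      \<omega> (x, u, p, w) (0, 0, 0, 1) * (dw - lam (x, u, p) * dx)
      + (\<Sum>a\<in>UNIV. \<omega> (x, u, p, w) (0, axis a 1, 0, 0) * (du $ a - p $ a * dx))
      + (\<Sum>a\<in>UNIV. \<omega> (x, u, p, w) (0, 0, axis a 1, 0) * (dp $ a - f (x, u, p) $ a * dx))"
    if "(x, u, p, w) \<in> covering M" for x u p w dx du dp dw
  proof -
    define T where "T = \<omega> (x, u, p, w)"
    have T: "linear T" using smooth_form1_linear[OF assms that] by (simp add: T_def)
    have T0: "T (1, p, f (x, u, p), lam (x, u, p)) = 0"
      using R that by (simp add: T_def covering_def)
    let ?l = "lam (x, u, p)" and ?f = "f (x, u, p)"
    have "(dx, du, dp, dw) = dx *\<^sub>R (1, p, ?f, ?l) + (dw - ?l * dx) *\<^sub>R (0, 0, 0, 1)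
        + (0, du - dx *\<^sub>R p, 0, 0) + (0, 0, dp - dx *\<^sub>R ?f, 0)"
      by simp
    then have "T (dx, du, dp, dw) = T (0, 0, 0, 1) * (dw - ?l * dx)
        + T (0, du - dx *\<^sub>R p, 0, 0) + T (0, 0, dp - dx *\<^sub>R ?f, 0)"
      by (simp only: linear_add[OF T] linear_cmul[OF T] T0) simp
    moreover have lin_u: "linear (\<lambda>y. T (0, y, 0, 0))"
      by (rule linear_compose[OF _ T, unfolded o_def]) (rule linearI, auto)
    moreover have lin_p: "linear (\<lambda>y. T (0, 0, y, 0))"
      by (rule linear_compose[OF _ T, unfolded o_def]) (rule linearI, auto)
    ultimately show ?thesis
      using linear_sum_axis[OF lin_u, of "du - dx *\<^sub>R p"]
        linear_sum_axis[OF lin_p, of "dp - dx *\<^sub>R ?f"]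
      unfolding T_def[symmetric] by (simp add: mult.commute)
  qed
  then show ?L
    unfolding contact_ideal_def mem_Collect_eq
    by (intro exI[of _ "\<lambda>z. \<omega> z (0, 0, 0, 1)"] exI[of _ "\<lambda>a z. \<omega> z (0, axis a 1, 0, 0)"]
        exI[of _ "\<lambda>a z. \<omega> z (0, 0, axis a 1, 0)"] conjI allI smooth_form1_smooth[OF assms] impI)
qed

lemma smooth_on_p_component:
  assumes "open M" shows "smooth_on (J1 M) (\<lambda>z. snd (snd z) $ a)"
  by (rule smooth_on_linear[OF open_J1[OF assms]]) (rule linearI, auto)

lemma poincare_cartan_conv:
  "poincare_cartan L z v =
    (\<Sum>a\<in>UNIV. pd_u1 a L z * (fst (snd v) $ a - snd (snd z) $ a * fst v)) + L z * fst v"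
  by (cases z; cases v) simp

lemma smooth_form1_poincare_cartan:
  assumes "open M" "smooth_on (J1 M) L"
  shows "smooth_form1 (J1 M) (poincare_cartan L)"
  unfolding smooth_form1_def
proof (intro conjI ballI allI)
  show "linear (poincare_cartan L z)" for z
    unfolding poincare_cartan_conv[abs_def]
    by (rule linearI) (auto simp: algebra_simps sum.distrib sum_subtractf sum_distrib_left)
  show "smooth_on (J1 M) (\<lambda>z. poincare_cartan L z v)" for v
    unfolding poincare_cartan_conv pd_u1_def
    by (intro smooth_on_add smooth_on_sum smooth_on_mult smooth_on_diff smooth_on_const
        smooth_on_derivative open_J1 assms smooth_on_p_component)
qed

lemma poincare_cartan_total: "poincare_cartan L (x, u, p) (t, t *\<^sub>R p, s) = t * L (x, u, p)"
  by simp

text \<open>As a derivative along a smooth field, here \<open>\<partial>\<^sub>x + u\<^sub>1\<^sup>a \<partial>\<^bsub>u\<^sup>a\<^esub>\<close>, the total derivative inherits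
  smoothness from the general lemma on such derivatives.\<close>

lemma Dx0_eq_vf_apply:
  assumes "smooth_on M g" "z \<in> J1 M"
  shows "Dx0 g z = vf_apply (\<lambda>y. (1, snd (snd y), 0)) (\<lambda>y. g (proj10 y)) z"
proof -
  obtain x u p where z: "z = (x, u, p)" by (metis prod_cases3)
  have "((\<lambda>y. g (proj10 y)) has_derivative
      (\<lambda>v. frechet_derivative g (at (proj10 z)) (proj10 v))) (at z)"
    using assms(2) by (intro has_derivative_compose_linear[OF linear_proj10]
        smooth_on_has_derivative[OF assms(1)]) (simp add: J1_vimage)
  from frechet_derivative_eqI[OF this] show ?thesis by (simp add: vf_apply_def z)
qed

lemma smooth_on_Dx0:
  assumes "open M" "smooth_on M g" shows "smooth_on (J1 M) (Dx0 g)"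
proof (rule smooth_on_cong[OF open_J1[OF assms(1)] Dx0_eq_vf_apply[OF assms(2), symmetric]])
  show "smooth_on (J1 M) (vf_apply (\<lambda>y. (1, snd (snd y), 0)) (\<lambda>y. g (proj10 y)))"
    using linear_snd_snd
    by (intro smooth_on_vf_apply smooth_on_J1_lift smooth_on_Pair smooth_on_const
        smooth_on_linear[where P = "\<lambda>y. snd (snd y)"] open_J1 assms)
qed

lemma lam_prolongation_conv:
  "lam_prolongation lam \<xi> \<eta> = (\<lambda>z. (\<xi> (proj10 z), \<eta> (proj10 z),
     \<chi> a. Dx0 (\<lambda>y. \<eta> y $ a) z - Dx0 \<xi> z * snd (snd z) $ a
           + lam z * (\<eta> (proj10 z) $ a - \<xi> (proj10 z) * snd (snd z) $ a)))"
  by (auto simp: fun_eq_iff)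

lemma smooth_on_lam_prolongation:
  assumes "open M" "smooth_on (J1 M) lam" "smooth_on M \<xi>" "smooth_on M \<eta>"
  shows "smooth_on (J1 M) (lam_prolongation lam \<xi> \<eta>)"
proof -
  have comp: "smooth_on M (\<lambda>y. \<eta> y $ a)" for a
    by (rule smooth_on_linear_image[OF assms(1) _ assms(4)]) (rule linearI, auto)
  show ?thesis
    unfolding lam_prolongation_conv
    by (intro smooth_on_Pair smooth_on_vec_lambda smooth_on_add smooth_on_diff smooth_on_mult
        smooth_on_Dx0 smooth_on_J1_lift[where g = \<xi>] smooth_on_J1_lift[where g = \<eta>]
        smooth_on_J1_lift[OF _ comp] comp
        smooth_on_p_component open_J1 assms)
qed

lemma cov_lift_conv:
  "cov_lift X A = (\<lambda>z. exp (cov_w z) *\<^sub>R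
    (fst (X (cov_proj z)), fst (snd (X (cov_proj z))), snd (snd (X (cov_proj z))), A z))"
  by (auto simp: fun_eq_iff split: prod.split)

lemma smooth_on_cov_lift:
  assumes "open M" "smooth_on (J1 M) X" "smooth_on (covering M) A"
  shows "smooth_on (covering M) (cov_lift X A)"
proof -
  have X: "smooth_on (covering M) (\<lambda>z. X (cov_proj z))"
    by (rule smooth_on_covering_lift[OF assms(1,2)])
  note comp = smooth_on_linear_image[OF open_covering[OF assms(1)] _ X]
  show ?thesis
    unfolding cov_lift_conv
    by (intro smooth_on_scaleR smooth_on_exp smooth_on_Pair smooth_on_linear[OF _ linear_cov_w]
        open_covering assms comp[of fst] comp[of "\<lambda>y. fst (snd y)"] comp[of "\<lambda>y. snd (snd y)"]
        linear_fst linear_fst_snd linear_snd_snd)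
qed


section \<open>The nonlocal field and the total derivative\<close>

text \<open>Differentiation along a vector with \<open>w\<close>-component \<open>l\<close> takes \<open>e\<^sup>w\<close> to \<open>l e\<^sup>w\<close>, so that
  \<open>e\<^sup>w\<close> turns the total derivative of the covering into \<open>D\<^sub>x + \<lambda>\<close> when \<open>l\<close> is the value of
  \<open>\<lambda>\<close>.\<close>

lemma exp_weighted_derivative:
  fixes g :: "'q::finite jet0 \<Rightarrow> 'b::euclidean_space"
  assumes "smooth_on M g" "(x, u) \<in> M"
  shows "frechet_derivative (\<lambda>z. exp (cov_w z) *\<^sub>R g (proj10 (cov_proj z))) (at (x, u, p, w))
      (1, p, s, l) = exp w *\<^sub>R (frechet_derivative g (at (x, u)) (1, p) + l *\<^sub>R g (x, u))"
proof -
  let ?z = "(x, u, p, w)"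
  have "((\<lambda>z. g (proj10 (cov_proj z))) has_derivative
      (\<lambda>v. frechet_derivative g (at (x, u)) (proj10 (cov_proj v)))) (at ?z)"
    using has_derivative_compose_linear[OF linear_compose[OF linear_cov_proj linear_proj10],
        of g _ ?z] smooth_on_has_derivative[OF assms] by (simp add: o_def)
  moreover have "((\<lambda>z. exp (cov_w z)) has_derivative (\<lambda>v. exp w * cov_w v)) (at ?z)"
    using has_derivative_compose_linear[OF linear_cov_w, of exp "\<lambda>v. v * exp w" ?z]
      has_derivative_exp[OF has_derivative_ident, of w UNIV] by (simp add: mult.commute)
  ultimately have "((\<lambda>z. exp (cov_w z) *\<^sub>R g (proj10 (cov_proj z))) has_derivative
      (\<lambda>v. exp (cov_w ?z) *\<^sub>R frechet_derivative g (at (x, u)) (proj10 (cov_proj v))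
        + (exp w * cov_w v) *\<^sub>R g (proj10 (cov_proj ?z)))) (at ?z)"
    by (intro has_derivative_scaleR)
  from frechet_derivative_eqI[OF this] show ?thesis by (simp add: scaleR_add_right)
qed

lemma frechet_derivative_linear_image:
  fixes P :: "'b::euclidean_space \<Rightarrow> 'c::real_normed_vector"
  assumes "linear P" "(f has_derivative D) (at z)"
  shows "P (D v) = frechet_derivative (\<lambda>y. P (f y)) (at z) v"
  by (rule sym, rule frechet_derivative_eqI, rule bounded_linear.has_derivative[OF _ assms(2)])
    (simp add: assms(1) linear_linear)

lemma frechet_derivative_component:
  fixes \<eta> :: "'a::euclidean_space \<Rightarrow> real^'q::finite"
  assumes "smooth_on S \<eta>" "z \<in> S"
  shows "frechet_derivative (\<lambda>y. \<eta> y $ a) (at z) v = frechet_derivative \<eta> (at z) v $ a"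
  using frechet_derivative_linear_image[OF _ smooth_on_has_derivative[OF assms], of "\<lambda>y. y $ a"]
  by (simp add: linearI)

text \<open>This is \<open>[D, Z] = t D\<close> modulo \<open>\<partial>\<^bsub>u\<^sub>1\<^esub>\<close> and \<open>\<partial>\<^sub>w\<close> at the point \<open>z\<close>, where \<open>D\<close> is the
  field \<open>(1, u\<^sub>1, s, l)\<close> with constants \<open>s\<close> and \<open>l\<close>, and \<open>l\<close> is the value of \<open>\<lambda>\<close> at \<open>z\<close>.
  The vector that is subtracted is the derivative of \<open>D\<close> in the direction \<open>Z\<close>.
  In the \<open>x\<close>-component, \<open>t\<close> is the derivative of \<open>e\<^sup>w \<xi>\<close>.  In the \<open>u\<close>-component,
  the derivative \<open>e\<^sup>w (D\<^sub>x + \<lambda>) \<eta>\<close> of \<open>e\<^sup>w \<eta>\<close> cancels against the \<open>\<lambda>\<close>-prolongation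
  formula, which leaves \<open>t u\<^sub>1\<close>.\<close>

lemma cov_lift_commutator:
  fixes M :: "'q::finite jet0 set" and u p s :: "real^'q" and x w :: real
  assumes "open M" "smooth_on (J1 M) lam" "smooth_on M \<xi>" "smooth_on M \<eta>"
    and "smooth_on (covering M) A" "(x, u) \<in> M"
  defines "Z \<equiv> cov_lift (lam_prolongation lam \<xi> \<eta>) A"
  defines "z \<equiv> (x, u, p, w)"
  defines "t \<equiv> exp w * Dx_lam lam \<xi> (x, u, p)"
  shows "\<exists>q. cov_proj (frechet_derivative Z (at z) (1, p, s, lam (x, u, p))
    - (0, fst (snd (snd (Z z))), 0, 0)) = (t, t *\<^sub>R p, q)"
proof -
  let ?V = "(1, p, s, lam (x, u, p))"
  have z: "z \<in> covering M" using assms(6) by (simp add: covering_def z_def)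
  have Z': "(Z has_derivative frechet_derivative Z (at z)) (at z)"
    unfolding Z_def by (intro smooth_on_has_derivative[OF _ z] smooth_on_cov_lift
        smooth_on_lam_prolongation assms)
  have x: "fst (Z y) = exp (cov_w y) *\<^sub>R \<xi> (proj10 (cov_proj y))" for y
    by (simp add: Z_def cov_lift_conv lam_prolongation_conv)
  have u: "fst (snd (Z y)) = exp (cov_w y) *\<^sub>R \<eta> (proj10 (cov_proj y))" for y
    by (simp add: Z_def cov_lift_conv lam_prolongation_conv)
  have "fst (frechet_derivative Z (at z) ?V) = t"
    using frechet_derivative_linear_image[OF linear_fst Z']
    by (simp only: x z_def exp_weighted_derivative[OF assms(3,6)]) (simp add: t_def Dx_lam_def)
  moreover have "fst (snd (frechet_derivative Z (at z) ?V)) = exp w *\<^sub>R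
      (frechet_derivative \<eta> (at (x, u)) (1, p) + lam (x, u, p) *\<^sub>R \<eta> (x, u))"
    using frechet_derivative_linear_image[OF linear_fst_snd Z']
    by (simp only: u z_def exp_weighted_derivative[OF assms(4,6)])
  moreover have "fst (snd (snd (Z z))) = exp w *\<^sub>R
      (frechet_derivative \<eta> (at (x, u)) (1, p) + lam (x, u, p) *\<^sub>R \<eta> (x, u)) - t *\<^sub>R p"
    by (simp add: Z_def z_def vec_eq_iff t_def Dx_lam_def
        frechet_derivative_component[OF assms(4,6)] algebra_simps)
  ultimately show ?thesis by (simp add: cov_proj_conv)
qed

text \<open>In \<open>Z(\<Theta>(D)) + \<Theta>([D, Z])\<close> the first term is \<open>e\<^sup>w X(L)\<close>, as \<open>\<Theta>(D) = L\<close> does not involve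
  \<open>w\<close>, and the second one is the factor \<open>e\<^sup>w (D\<^sub>x + \<lambda>) \<xi>\<close> of the commutator times \<open>L\<close>.\<close>

lemma lie_poincare_cartan_contract:
  fixes M :: "'q::finite jet0 set"
  assumes "open M" "smooth_on (J1 M) L" "smooth_on (J1 M) lam" "smooth_on M \<xi>" "smooth_on M \<eta>"
    and "smooth_on (covering M) A" "(x, u) \<in> M"
  shows "lie_derivative (cov_lift (lam_prolongation lam \<xi> \<eta>) A)
      (pullback cov_proj (poincare_cartan L)) (x, u, p, w) (1, p, s, lam (x, u, p)) =
    exp w * (vf_apply (lam_prolongation lam \<xi> \<eta>) L (x, u, p)
      + L (x, u, p) * Dx_lam lam \<xi> (x, u, p))"
proof -
  define Z where "Z = cov_lift (lam_prolongation lam \<xi> \<eta>) A"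
  define z where "z = (x, u, p, w)"
  \<comment> \<open>An extension of the given vector to a field with \<open>\<Theta>(D) = L\<close> everywhere.  With
    its last two components frozen at their values at \<open>z\<close>, it is an affine function.\<close>
  define D :: "'q cov \<Rightarrow> 'q cov" where "D y = (1, fst (snd (snd y)), s, lam (x, u, p))" for y
  define D' :: "'q cov \<Rightarrow> 'q cov" where "D' h = (0, fst (snd (snd h)), 0, 0)" for h
  have z: "z \<in> covering M" "(x, u, p) \<in> J1 M"
    using assms(7) by (simp_all add: covering_def J1_def z_def)
  have D: "(D has_derivative D') (at z)"
    unfolding D_def[abs_def] D'_def[abs_def] by (auto intro!: derivative_eq_intros simp: zero_prod_def)
  have \<Theta>: "smooth_form1 (covering M) (pullback cov_proj (poincare_cartan L))"
    unfolding covering_vimage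
    by (intro smooth_form1_pullback_linear linear_cov_proj open_J1 smooth_form1_poincare_cartan assms)
  have "pullback cov_proj (poincare_cartan L) y (D y) = L (cov_proj y)" for y
    by (cases y) (simp add: pullback_linear[OF linear_cov_proj] D_def)
  moreover have "((\<lambda>y. L (cov_proj y)) has_derivative
      (\<lambda>v. frechet_derivative L (at (x, u, p)) (cov_proj v))) (at z)"
    by (rule has_derivative_compose_linear[OF linear_cov_proj])
      (use smooth_on_has_derivative[OF assms(2) z(2)] in \<open>simp add: z_def\<close>)
  moreover have "cov_proj (Z z) = exp w *\<^sub>R lam_prolongation lam \<xi> \<eta> (x, u, p)"
    by (simp add: Z_def z_def split: prod.split)
  ultimately have "vf_apply Z (\<lambda>y. pullback cov_proj (poincare_cartan L) y (D y)) z
      = exp w * vf_apply (lam_prolongation lam \<xi> \<eta>) L (x, u, p)"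
    using frechet_derivative_eqI[of "\<lambda>y. L (cov_proj y)"]
      linear_cmul[OF smooth_on_linear_derivative[OF assms(2) z(2)]]
    by (simp add: vf_apply_def del: lam_prolongation.simps)
  moreover obtain q where q: "cov_proj (frechet_derivative Z (at z) (D z) - D' (Z z)) =
      (exp w * Dx_lam lam \<xi> (x, u, p), (exp w * Dx_lam lam \<xi> (x, u, p)) *\<^sub>R p, q)"
    using cov_lift_commutator[OF assms(1,3-7), of p w s]
    by (auto simp: Z_def z_def D_def D'_def)
  have "pullback cov_proj (poincare_cartan L) z (frechet_derivative Z (at z) (D z) - D' (Z z))
      = exp w * Dx_lam lam \<xi> (x, u, p) * L (x, u, p)"
    unfolding pullback_linear[OF linear_cov_proj] q
    by (simp only: z_def cov_proj.simps poincare_cartan_total)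
  ultimately have "lie_derivative Z (pullback cov_proj (poincare_cartan L)) z (D z) =
      exp w * (vf_apply (lam_prolongation lam \<xi> \<eta>) L (x, u, p)
        + L (x, u, p) * Dx_lam lam \<xi> (x, u, p))"
    unfolding lie_derivative_contract[OF open_covering[OF assms(1)] \<Theta> z(1) D]
    by (simp add: algebra_simps)
  then show ?thesis by (simp add: Z_def z_def D_def)
qed

theorem proposition2:
  fixes M :: "'q::finite jet0 set"
    and L lam :: "'q jet1 \<Rightarrow> real"
    and f :: "'q jet1 \<Rightarrow> real^'q"
    and \<xi> R :: "'q jet0 \<Rightarrow> real"
    and \<eta> :: "'q jet0 \<Rightarrow> real^'q"
  assumes "open M"
    and "regular_lagrangian M L"
    and "euler_lagrange_solved_form M L f"
    and "smooth_on (J1 M) lam"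
    and "smooth_on M \<xi>" and "smooth_on M \<eta>" and "smooth_on M R"
  shows "lam_variational_symmetry M L lam \<xi> \<eta> R \<longleftrightarrow>
    (\<forall>A. smooth_on (covering M) A \<longrightarrow>
       (\<lambda>z v. lie_derivative (cov_lift (lam_prolongation lam \<xi> \<eta>) A)
                (pullback cov_proj (poincare_cartan L)) z v
              - differential (\<lambda>z. exp (cov_w z) * R (proj10 (cov_proj z))) z v)
         \<in> contact_ideal M f lam)"
proof -
  have L: "smooth_on (J1 M) L" using assms(2) by (simp add: regular_lagrangian_def)
  define \<omega> where "\<omega> A = (\<lambda>z v. lie_derivative (cov_lift (lam_prolongation lam \<xi> \<eta>) A)
                (pullback cov_proj (poincare_cartan L)) z v
              - differential (\<lambda>z. exp (cov_w z) * R (proj10 (cov_proj z))) z v)" for A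
  have "\<omega> A \<in> contact_ideal M f lam \<longleftrightarrow> lam_variational_symmetry M L lam \<xi> \<eta> R"
    if A: "smooth_on (covering M) A" for A
  proof -
    have "smooth_form1 (covering M) (pullback cov_proj (poincare_cartan L))"
      unfolding covering_vimage
      by (intro smooth_form1_pullback_linear linear_cov_proj open_J1 smooth_form1_poincare_cartan
          assms L)
    then have "smooth_form1 (covering M) (\<omega> A)"
      unfolding \<omega>_def
      by (intro smooth_form1_diff smooth_form1_lie_derivative smooth_form1_differential
          smooth_on_cov_lift smooth_on_lam_prolongation smooth_on_mult smooth_on_exp
          smooth_on_linear[OF _ linear_cov_w] smooth_on_covering_lift[where g = "\<lambda>y. R (proj10 y)"]
          smooth_on_J1_lift open_covering assms A)
    moreover have "\<omega> A (x, u, p, w) (1, p, f (x, u, p), lam (x, u, p)) =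
        exp w * (vf_apply (lam_prolongation lam \<xi> \<eta>) L (x, u, p)
          + L (x, u, p) * Dx_lam lam \<xi> (x, u, p) - Dx_lam lam R (x, u, p))"
      if "(x, u) \<in> M" for x u p w
      using lie_poincare_cartan_contract[OF assms(1) L assms(4-6) A that]
        exp_weighted_derivative[OF assms(7) that]
      by (simp add: \<omega>_def differential_def Dx_lam_def algebra_simps)
    ultimately show ?thesis
      by (auto simp: contact_ideal_iff lam_variational_symmetry_def J1_def)
  qed
  \<comment> \<open>The converse needs some smooth \<open>A\<close> to start from; a constant serves.\<close>
  then show ?thesis unfolding \<omega>_def using smooth_on_const by blast
qed

end
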